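(* Let $a,b,n$ be positive integers with $ab\mid n$, let $G = C(n;a,b)$ be the associated one-paired circulant graph, and let $\alpha=\alpha(G)$. Then $\omega(G)=b$, $n=\alpha b$, and $G$ is a CIS graph. Furthermore, $G$ is well-covered.
   Context: For an integer $n\ge 1$ and a set $S\subseteq\{1,\ldots,\lfloor n/2\rfloor\}$, the circulant graph $C_n(S)$ has vertex set $\{0,1,\ldots,n-1\}$, and distinct $x,y$ are adjacent if and only if $|x-y|\in S$ or $n-|x-y|\in S$. For positive integers $a,b$ with $ab\mid n$, the one-paired circulant $C(n;a,b)$ is the circulant graph $C_n(S)$ with $S=\{d\in\{1,\ldots,\lfloor n/2\rfloor\} : a\mid d \text{ and } ab\nmid d\}$. $\alpha(G)$ is the largest cardinality of an independent set of $G$, and $\omega(G)$ is the largest cardinality of a clique of $G$. A graph $G$ is CIS if for every inclusion-maximal clique $C$ and every inclusion-maximal independent set $I$ of $G$, $C\cap I\neq\emptyset$. A graph is well-covered if all its inclusion-maximal independent sets have the same cardinality. *)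

theory Defs
  imports Main "HOL-Library.Ramsey"
begin

text \<open>A simple graph is a pair of a vertex set and a set of two-element edges, so that
  \<^const>\<open>clique\<close> and \<^const>\<open>indep\<close> from \<^theory>\<open>HOL-Library.Ramsey\<close> apply.  Those two predicates
  do not restrict to the vertex set; this is done below.\<close>

type_synonym 'a sgraph = "'a set \<times> 'a set set"

definition clique_in :: "'a sgraph \<Rightarrow> 'a set \<Rightarrow> bool" where
  "clique_in G C \<longleftrightarrow> C \<subseteq> fst G \<and> clique C (snd G)"

definition indep_in :: "'a sgraph \<Rightarrow> 'a set \<Rightarrow> bool" where
  "indep_in G I \<longleftrightarrow> I \<subseteq> fst G \<and> indep I (snd G)"

definition maximal_clique :: "'a sgraph \<Rightarrow> 'a set \<Rightarrow> bool" where
  "maximal_clique G C \<longleftrightarrow> clique_in G C \<and> (\<forall>D. clique_in G D \<and> C \<subseteq> D \<longrightarrow> D = C)"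

definition maximal_indep :: "'a sgraph \<Rightarrow> 'a set \<Rightarrow> bool" where
  "maximal_indep G I \<longleftrightarrow> indep_in G I \<and> (\<forall>J. indep_in G J \<and> I \<subseteq> J \<longrightarrow> J = I)"

text \<open>The following two numbers are meaningful for finite vertex sets only.\<close>

definition independence_number :: "'a sgraph \<Rightarrow> nat" where
  "independence_number G = Max (card ` {I. indep_in G I})"

definition clique_number :: "'a sgraph \<Rightarrow> nat" where
  "clique_number G = Max (card ` {C. clique_in G C})"

definition CIS :: "'a sgraph \<Rightarrow> bool" where
  "CIS G \<longleftrightarrow> (\<forall>C I. maximal_clique G C \<and> maximal_indep G I \<longrightarrow> C \<inter> I \<noteq> {})"

definition well_covered :: "'a sgraph \<Rightarrow> bool" where
  "well_covered G \<longleftrightarrow> (\<forall>I J. maximal_indep G I \<and> maximal_indep G J \<longrightarrow> card I = card J)"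

definition vdist :: "nat \<Rightarrow> nat \<Rightarrow> nat" where
  "vdist x y = nat \<bar>int x - int y\<bar>"

text \<open>Meant for \<^prop>\<open>n \<ge> 1\<close> and \<^prop>\<open>S \<subseteq> {1..n div 2}\<close>.  The truncated
  subtraction is harmless, as \<^term>\<open>vdist x y\<close> is less than \<^term>\<open>n\<close> for vertices.\<close>

definition circulant :: "nat \<Rightarrow> nat set \<Rightarrow> nat sgraph" where
  "circulant n S =
     ({0..<n},
      {{x, y} | x y. x \<in> {0..<n} \<and> y \<in> {0..<n} \<and> x \<noteq> y \<and>
                     (vdist x y \<in> S \<or> n - vdist x y \<in> S)})"

definition one_paired_circulant :: "nat \<Rightarrow> nat \<Rightarrow> nat \<Rightarrow> nat sgraph" where
  "one_paired_circulant n a b =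
     circulant n {d \<in> {1..n div 2}. a dvd d \<and> \<not> a * b dvd d}"

end

theory Submission
  imports Defs
begin

text \<open>Since \<open>a * b\<close> divides \<open>n\<close>, passing from a distance \<open>d\<close> to \<open>n - d\<close> affects neither
  divisibility by \<open>a\<close> nor by \<open>a * b\<close>, so two vertices are adjacent exactly if they agree modulo
  \<open>a\<close> but not modulo \<open>a * b\<close>.  Hence the graph is a disjoint union of \<open>a\<close> complete multipartite
  graphs, one for each residue modulo \<open>a\<close>; each of them has \<open>b\<close> parts, namely the residue classes
  modulo \<open>a * b\<close> inside it, and every part has \<open>n div (a * b)\<close> vertices.

  A maximal clique therefore lies in one component and picks one vertex from each part of it, while
  a maximal independent set consists of one whole part from each component.  Such sets have \<open>b\<close> and
  \<open>a * (n div (a * b))\<close> elements, respectively, and the part that the independent set contains in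
  the component of the clique is hit by the clique.\<close>

section \<open>Maximal cliques and independent sets of finite graphs\<close>

lemma maximal_clique_absorbs:
  assumes C: "maximal_clique G C" and v: "v \<in> fst G"
    and adj: "\<And>x. x \<in> C \<Longrightarrow> {v, x} \<in> snd G"
  shows "v \<in> C"
proof -
  have "clique_in G (insert v C)"
    using C v adj unfolding maximal_clique_def clique_in_def clique_def
    by (auto simp: insert_commute)
  then have "insert v C = C"
    using C unfolding maximal_clique_def by blast
  then show ?thesis by blast
qed

lemma maximal_indep_absorbs:
  assumes I: "maximal_indep G I" and v: "v \<in> fst G"
    and nonadj: "\<And>x. x \<in> I \<Longrightarrow> {v, x} \<notin> snd G"
  shows "v \<in> I"
proof -
  have "indep_in G (insert v I)"
    using I v nonadj unfolding maximal_indep_def indep_in_def indep_def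
    by (auto simp: insert_commute)
  then have "insert v I = I"
    using I unfolding maximal_indep_def by blast
  then show ?thesis by blast
qed

lemma Max_card_eqI:
  fixes P :: "'a set \<Rightarrow> bool"
  assumes V: "finite V" and sub: "\<And>X. P X \<Longrightarrow> X \<subseteq> V" and empty: "P {}"
    and maximal: "\<And>X. P X \<Longrightarrow> (\<And>Y. P Y \<Longrightarrow> X \<subseteq> Y \<Longrightarrow> Y = X) \<Longrightarrow> card X = k"
  shows "Max (card ` {X. P X}) = k"
proof -
  have fin: "finite {X. P X}"
    using sub by (intro finite_subset[OF _ finite_Pow_iff[THEN iffD2, OF V]]) auto
  have "Max (card ` {X. P X}) \<in> card ` {X. P X}"
    using fin empty by (intro Max_in) auto
  then obtain X where X: "P X" "card X = Max (card ` {X. P X})"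
    by auto
  \<comment> \<open>A set of largest cardinality is maximal for inclusion.\<close>
  have "Y = X" if "P Y" "X \<subseteq> Y" for Y
  proof -
    have "card Y \<le> card X" using X(2) fin that(1) by simp
    moreover have "finite Y" using sub[OF that(1)] V by (rule finite_subset)
    ultimately show ?thesis using that(2) card_seteq by blast
  qed
  with maximal X show ?thesis by metis
qed

lemma clique_number_eqI:
  assumes "finite (fst G)" and "\<And>C. maximal_clique G C \<Longrightarrow> card C = k"
  shows "clique_number G = k"
  unfolding clique_number_def
  by (rule Max_card_eqI[OF assms(1)])
    (use assms(2) in \<open>auto simp: maximal_clique_def clique_in_def clique_def\<close>)

lemma independence_number_eqI:
  assumes "finite (fst G)" and "\<And>I. maximal_indep G I \<Longrightarrow> card I = k"
  shows "independence_number G = k"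
  unfolding independence_number_def
  by (rule Max_card_eqI[OF assms(1)])
    (use assms(2) in \<open>auto simp: maximal_indep_def indep_in_def indep_def\<close>)

section \<open>Adjacency in terms of residues\<close>

lemma dvd_vdist_iff: "m dvd vdist x y \<longleftrightarrow> x mod m = y mod m"
proof -
  have "m dvd vdist x y \<longleftrightarrow> int m dvd int x - int y"
    unfolding vdist_def by (simp add: dvd_nat_abs_iff)
  also have "\<dots> \<longleftrightarrow> int x mod int m = int y mod int m"
    by (simp add: mod_eq_dvd_iff)
  finally show ?thesis by (simp flip: zmod_int)
qed

lemma fst_one_paired_circulant: "fst (one_paired_circulant n a b) = {0..<n}"
  by (simp add: one_paired_circulant_def circulant_def)

lemma adjacent_iff_mod:
  assumes dvd: "a * b dvd n"
  shows "{x, y} \<in> snd (one_paired_circulant n a b) \<longleftrightarrow>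
    x < n \<and> y < n \<and> x mod a = y mod a \<and> x mod (a * b) \<noteq> y mod (a * b)"
    (is "?L \<longleftrightarrow> ?R")
proof -
  define S where "S = {d \<in> {1..n div 2}. a dvd d \<and> \<not> a * b dvd d}"
  have sym: "vdist y x = vdist x y" for x y
    by (simp add: vdist_def abs_minus_commute)
  have L: "?L \<longleftrightarrow> x < n \<and> y < n \<and> x \<noteq> y \<and> (vdist x y \<in> S \<or> n - vdist x y \<in> S)"
    unfolding one_paired_circulant_def circulant_def S_def[symmetric]
    by (auto simp: doubleton_eq_iff sym)
  have S: "vdist x y \<in> S \<or> n - vdist x y \<in> S \<longleftrightarrow> a dvd vdist x y \<and> \<not> a * b dvd vdist x y"
    if "x < n" "y < n" "x \<noteq> y"
  proof -
    have d: "0 < vdist x y" "vdist x y < n"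
      using that by (auto simp: vdist_def)
    have a: "a dvd n" using dvd by (rule dvd_mult_left)
    have "m dvd n - vdist x y \<longleftrightarrow> m dvd vdist x y" if "m dvd n" for m
      using that d by (meson dvd_diffD dvd_diff_nat less_imp_le_nat dvd_diffD1)
    then have "a dvd n - vdist x y \<longleftrightarrow> a dvd vdist x y"
      "a * b dvd n - vdist x y \<longleftrightarrow> a * b dvd vdist x y"
      using a dvd by blast+
    moreover have "vdist x y \<in> {1..n div 2} \<or> n - vdist x y \<in> {1..n div 2}"
      using d by auto
    ultimately show ?thesis unfolding S_def by blast
  qed
  show ?thesis
    using L S by (auto simp: dvd_vdist_iff)
qed

section \<open>Maximal cliques are transversals of components\<close>

lemma maximal_clique_nonempty:
  assumes "maximal_clique G C" and "v \<in> fst G"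
  shows "C \<noteq> {}"
  using maximal_clique_absorbs[OF assms] by blast

lemma clique_mod_eq:
  assumes "a * b dvd n" and "clique_in (one_paired_circulant n a b) C" and "x \<in> C" and "y \<in> C"
  shows "x mod a = y mod a"
  using assms adjacent_iff_mod[OF assms(1), of x y] unfolding clique_in_def clique_def by metis

text \<open>A vertex in a missed part of the component would be adjacent to the whole clique.\<close>

lemma maximal_clique_meets_part:
  assumes dvd: "a * b dvd n" and C: "maximal_clique (one_paired_circulant n a b) C"
    and x: "x \<in> C" and v: "v < n" "v mod a = x mod a"
  shows "\<exists>y\<in>C. y mod (a * b) = v mod (a * b)"
proof (rule ccontr)
  assume none: "\<not> ?thesis"
  have clique: "clique_in (one_paired_circulant n a b) C"
    using C by (simp add: maximal_clique_def)
  have "v \<in> C"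
  proof (rule maximal_clique_absorbs[OF C])
    show "v \<in> fst (one_paired_circulant n a b)"
      using v by (simp add: fst_one_paired_circulant)
    show "{v, y} \<in> snd (one_paired_circulant n a b)" if y: "y \<in> C" for y
    proof -
      have "y < n" using clique y by (auto simp: clique_in_def fst_one_paired_circulant)
      moreover have "v mod a = y mod a" using clique_mod_eq[OF dvd clique x y] v by simp
      moreover have "v mod (a * b) \<noteq> y mod (a * b)" using none y by auto
      ultimately show ?thesis using v by (simp add: adjacent_iff_mod[OF dvd])
    qed
  qed
  with none show False by blast
qed

text \<open>A residue modulo \<open>a * b\<close> is \<open>r + a * j\<close> with \<open>r < a\<close> and \<open>j < b\<close>, and \<open>r\<close> is constant on
  the clique, so the digit \<open>j\<close> enumerates the parts of its component.\<close>

lemma card_maximal_clique: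
  assumes a: "a \<ge> 1" and b: "b \<ge> 1" and n: "n \<ge> 1" and dvd: "a * b dvd n"
    and C: "maximal_clique (one_paired_circulant n a b) C"
  shows "card C = b"
proof -
  let ?G = "one_paired_circulant n a b"
  let ?f = "\<lambda>x. x mod (a * b) div a"
  have clique: "clique_in ?G C" using C by (simp add: maximal_clique_def)
  have "C \<noteq> {}"
    using n by (intro maximal_clique_nonempty[OF C, of 0]) (simp add: fst_one_paired_circulant)
  then obtain x where x: "x \<in> C" by blast
  have "bij_betw ?f C {..<b}"
  proof (rule bij_betwI')
    fix y z assume y: "y \<in> C" and z: "z \<in> C"
    show "?f y = ?f z \<longleftrightarrow> y = z"
    proof
      assume "?f y = ?f z"
      moreover have "y mod a = z mod a" using clique_mod_eq[OF dvd clique y z] .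
      ultimately have "y mod (a * b) = z mod (a * b)"
        using a by (simp add: mod_mult2_eq)
      then show "y = z"
        using clique y z adjacent_iff_mod[OF dvd, of y z]
        unfolding clique_in_def clique_def by blast
    qed simp
  next
    fix y
    show "?f y \<in> {..<b}"
      using a b by (simp add: less_mult_imp_div_less mult.commute)
  next
    fix j assume "j \<in> {..<b}"
    then have j: "j < b" by simp
    define v where "v = x mod a + a * j"
    have xa: "x mod a < a" using a by simp
    have "v < a * Suc j" using xa by (simp add: v_def)
    also have "\<dots> \<le> a * b" using j by (intro mult_le_mono2) simp
    finally have v: "v < a * b" .
    also have "a * b \<le> n" using dvd n by (intro dvd_imp_le) auto
    finally have "v < n" .
    moreover have "v mod a = x mod a" by (simp add: v_def)
    ultimately obtain y where "y \<in> C" "y mod (a * b) = v mod (a * b)"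
      using maximal_clique_meets_part[OF dvd C x] by blast
    moreover have "v div a = j" using a by (simp add: v_def)
    ultimately show "\<exists>y\<in>C. j = ?f y" using v by auto
  qed
  then show ?thesis by (auto dest: bij_betw_same_card)
qed

section \<open>Maximal independent sets are unions of parts, one from each component\<close>

lemma indep_mod_eq:
  assumes "a * b dvd n" and "indep_in (one_paired_circulant n a b) I"
    and "x \<in> I" and "y \<in> I" and "x mod a = y mod a"
  shows "x mod (a * b) = y mod (a * b)"
proof -
  have "x < n" "y < n"
    using assms by (auto simp: indep_in_def fst_one_paired_circulant)
  moreover have "x = y \<or> {x, y} \<notin> snd (one_paired_circulant n a b)"
    using assms by (auto simp: indep_in_def indep_def)
  ultimately show ?thesis
    using adjacent_iff_mod[OF assms(1), of x y] assms(5) by blast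
qed

text \<open>Vertices of the same part have the same neighbours, so an independent set can be enlarged by
  all vertices of each part that it meets.\<close>

lemma maximal_indep_closed:
  assumes dvd: "a * b dvd n" and I: "maximal_indep (one_paired_circulant n a b) I"
    and x: "x \<in> I" and v: "v < n" "v mod (a * b) = x mod (a * b)"
  shows "v \<in> I"
proof (rule maximal_indep_absorbs[OF I])
  have indep: "indep_in (one_paired_circulant n a b) I"
    using I by (simp add: maximal_indep_def)
  show "v \<in> fst (one_paired_circulant n a b)"
    using v by (simp add: fst_one_paired_circulant)
  fix y assume y: "y \<in> I"
  have "v mod a = x mod a"
    using v(2) by (metis mod_mod_cancel dvd_triv_left)
  then show "{v, y} \<notin> snd (one_paired_circulant n a b)"
    using indep_mod_eq[OF dvd indep x y] v(2) by (simp add: adjacent_iff_mod[OF dvd])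
qed

text \<open>A vertex in a missed component would have no neighbour in the independent set.\<close>

lemma maximal_indep_meets_component:
  assumes dvd: "a * b dvd n" and I: "maximal_indep (one_paired_circulant n a b) I" and v: "v < n"
  shows "\<exists>x\<in>I. x mod a = v mod a"
proof (rule ccontr)
  assume none: "\<not> ?thesis"
  then have "{v, x} \<notin> snd (one_paired_circulant n a b)" if "x \<in> I" for x
    using that by (auto simp: adjacent_iff_mod[OF dvd])
  then have "v \<in> I"
    using maximal_indep_absorbs[OF I] v by (simp add: fst_one_paired_circulant)
  with none show False by blast
qed

text \<open>A vertex of the independent set is determined by its component, which is its residue modulo
  \<open>a\<close>, and by its position inside the chosen part, which is its quotient by \<open>a * b\<close>.\<close>

lemma card_maximal_indep:
  assumes a: "a \<ge> 1" and b: "b \<ge> 1" and n: "n \<ge> 1" and dvd: "a * b dvd n"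
    and I: "maximal_indep (one_paired_circulant n a b) I"
  shows "card I = n div (a * b) * a"
proof -
  let ?m = "a * b"
  let ?f = "\<lambda>x. (x div ?m, x mod a)"
  have indep: "indep_in (one_paired_circulant n a b) I"
    using I by (simp add: maximal_indep_def)
  have m: "?m > 0" using a b by simp
  have n_eq: "n = n div ?m * ?m" using dvd by simp
  have "bij_betw ?f I ({..<n div ?m} \<times> {..<a})"
  proof (rule bij_betwI')
    fix x y assume x: "x \<in> I" and y: "y \<in> I"
    show "?f x = ?f y \<longleftrightarrow> x = y"
    proof
      assume eq: "?f x = ?f y"
      then have "x mod ?m = y mod ?m" using indep_mod_eq[OF dvd indep x y] by simp
      with eq show "x = y" by (metis prod.inject div_mult_mod_eq)
    qed simp
  next
    fix x assume "x \<in> I"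
    then have "x < n div ?m * ?m"
      using indep n_eq by (auto simp: indep_in_def fst_one_paired_circulant)
    then have "x div ?m < n div ?m" by (rule less_mult_imp_div_less)
    then show "?f x \<in> {..<n div ?m} \<times> {..<a}" using a by simp
  next
    fix p assume "p \<in> {..<n div ?m} \<times> {..<a}"
    then obtain q r where p: "p = (q, r)" and q: "q < n div ?m" and r: "r < a" by auto
    have "a \<le> n" using dvd n a by (meson dvd_imp_le dvd_mult_left le_trans zero_less_one less_le_trans)
    then obtain x where x: "x \<in> I" "x mod a = r"
      using maximal_indep_meets_component[OF dvd I, of r] r by auto
    define y where "y = q * ?m + x mod ?m"
    have y_mod: "y mod ?m = x mod ?m" by (simp add: y_def)
    have "y < Suc q * ?m" using m by (simp add: y_def)
    also have "\<dots> \<le> n div ?m * ?m" using q by (intro mult_le_mono1) simp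
    finally have "y < n" using n_eq by simp
    then have "y \<in> I" using maximal_indep_closed[OF dvd I x(1) _ y_mod] by simp
    moreover have "y div ?m = q"
      using a b by (simp add: y_def)
    moreover have "y mod a = r"
      using y_mod x(2) by (metis mod_mod_cancel dvd_triv_left)
    ultimately show "\<exists>y\<in>I. p = ?f y" using p by auto
  qed
  from bij_betw_same_card[OF this] show ?thesis by (simp add: card_cartesian_product)
qed

section \<open>Every maximal clique meets every maximal independent set\<close>

lemma CIS_one_paired_circulant:
  assumes n: "n \<ge> 1" and dvd: "a * b dvd n"
  shows "CIS (one_paired_circulant n a b)"
  unfolding CIS_def
proof (intro allI impI, elim conjE)
  let ?G = "one_paired_circulant n a b"
  fix C I assume C: "maximal_clique ?G C" and I: "maximal_indep ?G I"
  have "clique_in ?G C" and "indep_in ?G I"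
    using C I by (simp_all add: maximal_clique_def maximal_indep_def)
  then have vertex: "v < n" if "v \<in> C \<union> I" for v
    using that by (auto simp: clique_in_def indep_in_def fst_one_paired_circulant)
  have "C \<noteq> {}"
    using n by (intro maximal_clique_nonempty[OF C, of 0]) (simp add: fst_one_paired_circulant)
  then obtain x where x: "x \<in> C" by blast
  obtain i where i: "i \<in> I" "i mod a = x mod a"
    using maximal_indep_meets_component[OF dvd I, of x] vertex[of x] x by blast
  obtain y where y: "y \<in> C" "y mod (a * b) = i mod (a * b)"
    using maximal_clique_meets_part[OF dvd C x _ i(2)] vertex[of i] i(1) by blast
  have "y \<in> I"
    using maximal_indep_closed[OF dvd I i(1) _ y(2)] vertex[of y] y(1) by blast
  with y show "C \<inter> I \<noteq> {}" by blast
qed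

theorem corollary5p7:
  fixes a b n :: nat
  assumes "a \<ge> 1" and "b \<ge> 1" and "n \<ge> 1" and "a * b dvd n"
  shows "let G = one_paired_circulant n a b; \<alpha> = independence_number G in
           clique_number G = b \<and> n = \<alpha> * b \<and> CIS G \<and> well_covered G"
proof -
  let ?G = "one_paired_circulant n a b"
  have fin: "finite (fst ?G)" by (simp add: fst_one_paired_circulant)
  have "clique_number ?G = b"
    using clique_number_eqI[OF fin] card_maximal_clique[OF assms] by blast
  moreover have "independence_number ?G = n div (a * b) * a"
    using independence_number_eqI[OF fin] card_maximal_indep[OF assms] by blast
  then have "n = independence_number ?G * b"
    using assms(4) by (simp add: mult.assoc)
  moreover have "CIS ?G"
    using CIS_one_paired_circulant[OF assms(3,4)] .
  moreover have "well_covered ?G"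
    unfolding well_covered_def using card_maximal_indep[OF assms] by simp
  ultimately show ?thesis by (simp add: Let_def)
qed

end
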